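(* Let $\epsilon\in(0,2/5]$ and $\alpha>(2-4\epsilon)/(3-4\epsilon)$ be constants, and let $H$ be a graph with $\mathrm{ex}(n,H)=O(n^{2-\alpha})$. If $H$ has a vertex whose removal results in a bipartite graph $B$ with $\mathrm{ex}(n,B)=\Theta(n^{2-\epsilon})$, then there exist constants $\epsilon(H)>0$ and $C>0$ such that $\mathrm{sp}(m,H)\ge C m^{3/4+\epsilon(H)}$ for all $m\ge1$.
   Context: For a graph $G$ with $m$ edges, $\mathrm{sp}(G)=\mathrm{mc}(G)-m/2$, where $\mathrm{mc}(G)$ is the maximum number of edges crossing a bipartition of $V(G)$. $\mathrm{sp}(m,H)$ is the minimum of $\mathrm{sp}(G)$ over all $H$-free graphs $G$ with $m$ edges. $\mathrm{ex}(n,F)$ is the maximum number of edges of an $n$-vertex $F$-free graph. *)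

theory Defs
  imports Complex_Main "HOL-Library.Landau_Symbols"
begin

type_synonym 'a ugraph = "'a set \<times> 'a set set"

abbreviation verts :: "'a ugraph \<Rightarrow> 'a set" where
  "verts G \<equiv> fst G"

abbreviation edges :: "'a ugraph \<Rightarrow> 'a set set" where
  "edges G \<equiv> snd G"

definition simple_graph :: "'a ugraph \<Rightarrow> bool" where
  "simple_graph G \<longleftrightarrow> finite (verts G) \<and> (\<forall>e\<in>edges G. e \<subseteq> verts G \<and> card e = 2)"

text \<open>Subgraph copies are not required to be induced.\<close>

definition contains_copy :: "'b ugraph \<Rightarrow> 'a ugraph \<Rightarrow> bool" where
  "contains_copy G H \<longleftrightarrow>
     (\<exists>f. inj_on f (verts H) \<and> f ` verts H \<subseteq> verts G \<and> (\<forall>e\<in>edges H. f ` e \<in> edges G))"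

definition free_of :: "'a ugraph \<Rightarrow> 'b ugraph \<Rightarrow> bool" where
  "free_of H G \<longleftrightarrow> \<not> contains_copy G H"

definition delete_vertex :: "'a ugraph \<Rightarrow> 'a \<Rightarrow> 'a ugraph" where
  "delete_vertex G v = (verts G - {v}, {e \<in> edges G. v \<notin> e})"

definition crossing_edges :: "'a ugraph \<Rightarrow> 'a set \<Rightarrow> 'a set set" where
  "crossing_edges G A = {e \<in> edges G. e \<inter> A \<noteq> {} \<and> e \<inter> (verts G - A) \<noteq> {}}"

definition bipartite :: "'a ugraph \<Rightarrow> bool" where
  "bipartite G \<longleftrightarrow> (\<exists>A \<subseteq> verts G. crossing_edges G A = edges G)"

definition mc :: "'a ugraph \<Rightarrow> nat" where
  "mc G = Max {card (crossing_edges G A) | A. A \<subseteq> verts G}"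

definition surplus :: "'a ugraph \<Rightarrow> real" where
  "surplus G = real (mc G) - real (card (edges G)) / 2"

text \<open>In the next two definitions the graphs \<open>G\<close> have natural numbers as vertices; every
  finite graph has an isomorphic copy of this kind.  Both range over finite sets of values
  (see below).  These sets can be empty only when \<open>F\<close> or \<open>H\<close>
  has at most one edge; the value is then the unspecified constant \<open>Max {}\<close> or \<open>Min {}\<close>.\<close>

definition ex_number :: "nat \<Rightarrow> 'a ugraph \<Rightarrow> nat" where
  "ex_number n F =
     Max {card (edges G) | G :: nat ugraph. simple_graph G \<and> card (verts G) = n \<and> free_of F G}"

definition sp_min :: "nat \<Rightarrow> 'a ugraph \<Rightarrow> real" where
  "sp_min m H =
     Min {surplus G | G :: nat ugraph. simple_graph G \<and> card (edges G) = m \<and> free_of H G}"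

lemma finite_edges: "simple_graph G \<Longrightarrow> finite (edges G)"
  unfolding simple_graph_def by (rule finite_subset[of _ "Pow (verts G)"]) auto

lemma mc_le:
  assumes "simple_graph G"
  shows "mc G \<le> card (edges G)"
proof -
  have "finite (verts G)" using assms by (simp add: simple_graph_def)
  then have "finite {card (crossing_edges G A) | A. A \<subseteq> verts G}"
    by simp
  moreover have "card (crossing_edges G A) \<le> card (edges G)" for A
    by (rule card_mono[OF finite_edges[OF assms]]) (auto simp: crossing_edges_def)
  ultimately show ?thesis
    unfolding mc_def by (subst Max_le_iff) auto
qed

lemma finite_ex_number_values:
  "finite {card (edges G) | G :: nat ugraph. simple_graph G \<and> card (verts G) = n \<and> free_of F G}"
proof (rule finite_subset[of _ "{..2 ^ n}"])
  have "card (edges G) \<le> 2 ^ card (verts G)" if "simple_graph G" for G :: "nat ugraph"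
  proof -
    have "card (edges G) \<le> card (Pow (verts G))"
      using that by (intro card_mono) (auto simp: simple_graph_def)
    then show ?thesis using that by (simp add: card_Pow simple_graph_def)
  qed
  then show "{card (edges G) | G :: nat ugraph.
      simple_graph G \<and> card (verts G) = n \<and> free_of F G} \<subseteq> {..2 ^ n}"
    by blast
qed simp

lemma finite_sp_min_values:
  "finite {surplus G | G :: nat ugraph. simple_graph G \<and> card (edges G) = m \<and> free_of H G}"
proof (rule finite_subset[of _ "(\<lambda>k. real k - real m / 2) ` {..m}"])
  show "{surplus G | G :: nat ugraph. simple_graph G \<and> card (edges G) = m \<and> free_of H G}
      \<subseteq> (\<lambda>k. real k - real m / 2) ` {..m}"
    using mc_le unfolding surplus_def by fastforce
qed simp

end

theory Submission
  imports Defs "HOL-Library.FuncSet"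
begin

text \<open>
  An \<open>H\<close>-free graph with \<open>m\<close> edges is \<open>D\<close>-degenerate with
  \<open>D = O(m powr ((1 - \<alpha>) / (2 - \<alpha>)))\<close>. Order the vertices so that each has a set \<open>N u\<close>
  of at most \<open>D\<close> earlier neighbours, draw independent random signs \<open>s\<close>, and put
  \<open>y u = sin (\<pi> / 4 * s u - \<theta> * (\<Sum>w\<in>N u. s w))\<close>. Expectations of cosines of signed sums
  factorise, and for an edge \<open>u v\<close> this gives
  \<open>E (y u * y v) \<le> \<theta>\<^sup>2 * card (N u \<inter> N v) - \<theta> / 8\<close>. Summed over all edges, the common
  earlier neighbours count the edges inside the sets \<open>N u\<close>; these span \<open>B\<close>-free graphs,
  so there are \<open>O(m * D powr (1 - \<epsilon>))\<close> of them. Since \<open>\<Sum> y u * y v\<close> is affine in each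
  coordinate, rounding \<open>y\<close> to a cut yields surplus of order \<open>\<theta> * m\<close>. The best choice
  \<open>\<theta> = \<Theta>(D powr (\<epsilon> - 1))\<close> gives the exponent \<open>1 - (1 - \<epsilon>) * (1 - \<alpha>) / (2 - \<alpha>)\<close>, which exceeds
  \<open>3 / 4\<close> exactly when \<open>\<alpha> > (2 - 4 * \<epsilon>) / (3 - 4 * \<epsilon>)\<close>.

  The lower bound on \<open>ex(n, B)\<close> only serves to exclude the degenerate \<open>H\<close> for which
  \<open>sp_min m H\<close> is the unspecified \<open>Min {}\<close>.
\<close>

subsection \<open>Rounding fractional cuts\<close>

text \<open>An affine function on \<open>[-1, 1]\<close> is smallest at an endpoint, so the
  coordinates can be pushed to signs one at a time without raising \<open>F\<close>. Affinity is
  assumed at every point \<open>y\<close>, so it survives each push.\<close>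

lemma coordinatewise_affine_rounding:
  fixes F :: "('a \<Rightarrow> real) \<Rightarrow> real"
  assumes "finite V"
    and "\<And>y v. \<exists>a b. \<forall>t. F (y(v := t)) = a + b * t"
    and "\<And>v. v \<in> V \<Longrightarrow> \<bar>y v\<bar> \<le> 1"
  shows "\<exists>s. (\<forall>v\<in>V. s v \<in> {-1, 1}) \<and> (\<forall>v. v \<notin> V \<longrightarrow> s v = y v) \<and> F s \<le> F y"
  using assms(1,3)
proof (induction V arbitrary: y rule: finite_induct)
  case empty
  then show ?case by auto
next
  case (insert x V)
  obtain a b where ab: "\<And>t. F (y(x := t)) = a + b * t"
    using assms(2)[of y x] by auto
  define t :: real where "t = (if b \<ge> 0 then -1 else 1)"
  have yx: "\<bar>y x\<bar> \<le> 1" using insert.prems by simp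
  have "b * t \<le> b * y x"
  proof (cases "b \<ge> 0")
    case True
    then show ?thesis using yx by (intro mult_left_mono) (auto simp: t_def)
  next
    case False
    then show ?thesis using yx by (intro mult_left_mono_neg) (auto simp: t_def)
  qed
  then have le: "F (y(x := t)) \<le> F y"
    using ab[of t] ab[of "y x"] by simp
  have "\<And>v. v \<in> V \<Longrightarrow> \<bar>(y(x := t)) v\<bar> \<le> 1"
    using insert.prems by (auto simp: t_def)
  from insert.IH[of "y(x := t)", OF this] obtain s where s: "\<forall>v\<in>V. s v \<in> {-1, 1}"
      "\<forall>v. v \<notin> V \<longrightarrow> s v = (y(x := t)) v" "F s \<le> F (y(x := t))"
    by blast
  have "s x = t" using s(2) insert.hyps by simp
  then have "\<forall>v\<in>insert x V. s v \<in> {-1, 1}" using s(1) by (auto simp: t_def)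
  moreover have "\<forall>v. v \<notin> insert x V \<longrightarrow> s v = y v" using s(2) by simp
  ultimately show ?case using s(3) le by (intro exI[of _ s]) auto
qed

lemma crossing_edges_le_mc:
  assumes "simple_graph G" "A \<subseteq> verts G"
  shows "card (crossing_edges G A) \<le> mc G"
  unfolding mc_def
proof (rule Max_ge)
  show "finite {card (crossing_edges G A) | A. A \<subseteq> verts G}"
    using assms(1) by (simp add: simple_graph_def)
qed (use assms(2) in auto)

text \<open>A vertex occurs at most once in the product over an edge, so the sum is affine in each
  coordinate and \<open>y\<close> can be rounded to signs. For signs, a crossing edge contributes -1
  and any other edge 1, so the sum is the number of edges minus twice the size of the cut.\<close>

lemma surplus_ge_edge_correlation:
  fixes G :: "'a ugraph" and y :: "'a \<Rightarrow> real"
  assumes G: "simple_graph G"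
    and y: "\<And>v. v \<in> verts G \<Longrightarrow> \<bar>y v\<bar> \<le> 1"
  shows "surplus G \<ge> - (\<Sum>e\<in>edges G. \<Prod>v\<in>e. y v) / 2"
proof -
  define F where "F y = (\<Sum>e\<in>edges G. \<Prod>v\<in>e. y v)" for y :: "'a \<Rightarrow> real"
  have finV: "finite (verts G)" and finE: "finite (edges G)"
    using G finite_edges[OF G] unfolding simple_graph_def by blast+
  have fine: "finite e" if "e \<in> edges G" for e
    using that G finV by (auto simp: simple_graph_def intro: finite_subset)
  have "\<exists>a b. \<forall>t. F (y(v := t)) = a + b * t" for y v
  proof (intro exI allI)
    fix t
    \<comment> \<open>Edges avoiding \<open>v\<close> form the constant term, edges through
      \<open>v\<close> the slope.\<close>
    have "(\<Prod>w\<in>e. (y(v := t)) w) =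
        (if v \<in> e then 0 else \<Prod>w\<in>e. y w) + (if v \<in> e then \<Prod>w\<in>e - {v}. y w else 0) * t"
      if "e \<in> edges G" for e
    proof (cases "v \<in> e")
      case True
      have "(\<Prod>w\<in>e - {v}. (y(v := t)) w) = (\<Prod>w\<in>e - {v}. y w)"
        by (rule prod.cong) auto
      then show ?thesis using True prod.remove[OF fine[OF that] True, of "y(v := t)"] by simp
    next
      case False
      then have "(\<Prod>w\<in>e. (y(v := t)) w) = (\<Prod>w\<in>e. y w)"
        by (intro prod.cong) auto
      then show ?thesis using False by simp
    qed
    then show "F (y(v := t)) = (\<Sum>e\<in>edges G. if v \<in> e then 0 else \<Prod>w\<in>e. y w)
        + (\<Sum>e\<in>edges G. if v \<in> e then \<Prod>w\<in>e - {v}. y w else 0) * t"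
      unfolding F_def by (simp add: sum.distrib sum_distrib_right)
  qed
  from coordinatewise_affine_rounding[of "verts G" F y, OF finV this y]
  obtain s where s: "\<forall>v\<in>verts G. s v \<in> {-1, 1}" and le: "F s \<le> F y"
    by blast
  define A where "A = {v \<in> verts G. s v = 1}"
  have pr: "(\<Prod>v\<in>e. s v) = 1 - 2 * (if e \<in> crossing_edges G A then 1 else 0)"
    if e: "e \<in> edges G" for e
  proof -
    obtain a b where ab: "e = {a, b}" "a \<noteq> b"
      using e G unfolding simple_graph_def by (meson card_2_iff)
    have V: "a \<in> verts G" "b \<in> verts G"
      using e G ab unfolding simple_graph_def by auto
    have "s a \<in> {-1, 1}" "s b \<in> {-1, 1}" using s V by auto
    then show ?thesis
      using ab V e by (auto simp: crossing_edges_def A_def)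
  qed
  have "F s = (\<Sum>e\<in>edges G. 1 - 2 * (if e \<in> crossing_edges G A then 1 else 0))"
    unfolding F_def by (rule sum.cong[OF refl pr])
  also have "\<dots> = real (card (edges G)) - 2 * (\<Sum>e\<in>edges G. if e \<in> crossing_edges G A then 1 else 0)"
    unfolding sum_subtractf sum_distrib_left[symmetric] by simp
  also have "(\<Sum>e\<in>edges G. if e \<in> crossing_edges G A then 1 else (0::real)) = card (crossing_edges G A)"
  proof -
    have "edges G \<inter> {e. e \<in> crossing_edges G A} = crossing_edges G A"
      by (auto simp: crossing_edges_def)
    then show ?thesis using finE by (simp add: sum.If_cases)
  qed
  finally have "F s = card (edges G) - 2 * real (card (crossing_edges G A))" .
  moreover have "card (crossing_edges G A) \<le> mc G"
    by (rule crossing_edges_le_mc[OF G]) (auto simp: A_def)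
  ultimately have "surplus G \<ge> - F y / 2"
    using le unfolding surplus_def by linarith
  then show ?thesis unfolding F_def .
qed

subsection \<open>Perturbed random signs\<close>

text \<open>This is the characteristic function of independent signs, left unnormalised:
  \<open>cis\<close> turns the sum over \<open>V\<close> into a product, each factor sums to
  \<open>2 * cos (a v)\<close>, and the real part is taken at the end.\<close>

lemma sum_signs_cos:
  fixes a :: "'a \<Rightarrow> real"
  assumes "finite V"
  shows "(\<Sum>s\<in>V \<rightarrow>\<^sub>E {-1, 1}. cos (\<Sum>v\<in>V. a v * s v)) = 2 ^ card V * (\<Prod>v\<in>V. cos (a v))"
proof -
  have "(\<Sum>s\<in>V \<rightarrow>\<^sub>E {-1, 1}. cis (\<Sum>v\<in>V. a v * s v))
      = (\<Sum>s\<in>V \<rightarrow>\<^sub>E {-1, 1}. \<Prod>v\<in>V. cis (a v * s v))"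
    using assms by (intro sum.cong refl) (simp add: cis_conv_exp exp_sum sum_distrib_left)
  also have "\<dots> = (\<Prod>v\<in>V. \<Sum>t\<in>{-1, 1}. cis (a v * t))"
    using assms by (subst prod_sum_PiE) auto
  also have "\<dots> = (\<Prod>v\<in>V. of_real (2 * cos (a v)))"
    by (intro prod.cong refl) (simp add: complex_eq_iff)
  also have "\<dots> = of_real (2 ^ card V * (\<Prod>v\<in>V. cos (a v)))"
    by (simp add: prod.distrib)
  finally have "Re (\<Sum>s\<in>V \<rightarrow>\<^sub>E {-1, 1}. cis (\<Sum>v\<in>V. a v * s v))
      = Re (of_real (2 ^ card V * (\<Prod>v\<in>V. cos (a v))))"
    by (rule arg_cong)
  then show ?thesis unfolding Re_sum cis.sel Re_complex_of_real .
qed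

lemma cos_ge_one_minus_square: "1 - x\<^sup>2 / 2 \<le> cos (x :: real)"
proof -
  have "(sin (x / 2))\<^sup>2 \<le> (x / 2)\<^sup>2"
    using abs_sin_x_le_abs_x[of "x / 2"] by (simp only: abs_le_square_iff)
  then show ?thesis
    using cos_double_sin[of "x / 2"] by (simp add: power_divide)
qed

lemma half_le_sin:
  fixes x :: real
  assumes "0 \<le> x" "x \<le> 1"
  shows "x / 2 \<le> sin x"
proof (cases "x = 0")
  case False
  then obtain z where z: "0 < z" "z < x" "sin x - sin 0 = (x - 0) * cos z"
    using MVT2[of 0 x sin cos] assms by (auto intro: DERIV_sin)
  have "z\<^sup>2 \<le> 1" using z assms by (simp add: power_le_one)
  then have "1 / 2 \<le> cos z" using cos_ge_one_minus_square[of z] by simp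
  then show ?thesis using z assms mult_left_mono[of "1/2" "cos z" x] by simp
qed simp

text \<open>Bernoulli's inequality for the base \<open>1 - x\<^sup>2 / 2\<close>, which the
  hypothesis keeps nonnegative so that powers are monotone.\<close>

lemma power_cos_ge:
  fixes x :: real
  assumes "x\<^sup>2 \<le> 1"
  shows "(cos x) ^ k \<ge> 1 - k * x\<^sup>2 / 2"
proof -
  have "1 + k * (- (x\<^sup>2 / 2)) \<le> (1 + - (x\<^sup>2 / 2)) ^ k"
    using assms by (intro Bernoulli_inequality) simp
  also have "\<dots> \<le> (cos x) ^ k"
    using assms cos_ge_one_minus_square[of x] by (intro power_mono) auto
  finally show ?thesis by simp
qed

text \<open>With an own angle \<open>\<phi>\<close>, the gain along an edge would carry the factor
  \<open>sin (2 * \<phi>)\<close>; \<open>pi / 4\<close> makes it 1. The negative sign at earlier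
  neighbours pushes \<open>u\<close> to the opposite side from them.\<close>

definition perturbed_coeff :: "('a \<Rightarrow> 'a set) \<Rightarrow> real \<Rightarrow> 'a \<Rightarrow> 'a \<Rightarrow> real" where
  "perturbed_coeff N \<theta> u w = (if w = u then pi / 4 else if w \<in> N u then - \<theta> else 0)"

text \<open>The sine keeps the values in \<open>[-1, 1]\<close>, as rounding requires, and makes a
  product of two of them a difference of cosines.\<close>

definition perturbed_sign :: "'a set \<Rightarrow> ('a \<Rightarrow> 'a set) \<Rightarrow> real \<Rightarrow> ('a \<Rightarrow> real) \<Rightarrow> 'a \<Rightarrow> real" where
  "perturbed_sign V N \<theta> s u = sin (\<Sum>w\<in>V. perturbed_coeff N \<theta> u w * s w)"

text \<open>Up to the factor \<open>2 ^ card V\<close>, the sum is \<open>(X - Y) / 2\<close> for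
  two products of cosines. The edge itself makes \<open>Y\<close> exceed \<open>X\<close> through a
  term \<open>sin \<theta>\<close>; common members of \<open>N u\<close> and \<open>N v\<close> damp
  only \<open>Y\<close>, which costs at most \<open>\<theta>\<^sup>2\<close> for each. The bound on
  \<open>D * \<theta>\<^sup>2\<close> keeps the damping \<open>P\<close> shared by both products at
  least 1/2.\<close>

lemma sum_perturbed_sign_mult:
  fixes \<theta> D :: real
  assumes fin: "finite V" and N: "N u \<subseteq> V" "N v \<subseteq> V" and uv: "u \<in> V" "v \<in> N u"
    and nin: "u \<notin> N u" "v \<notin> N v" "u \<notin> N v"
    and D: "card (N u) \<le> D" "card (N v) \<le> D"
    and \<theta>: "0 \<le> \<theta>" "\<theta> \<le> 1 / 2" "D * \<theta>\<^sup>2 \<le> 1 / 2"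
  shows "(\<Sum>s\<in>V \<rightarrow>\<^sub>E {-1, 1}. perturbed_sign V N \<theta> s u * perturbed_sign V N \<theta> s v)
      \<le> 2 ^ card V * (\<theta>\<^sup>2 * card (N u \<inter> N v) - \<theta> / 8)"
proof -
  define a where "a = perturbed_coeff N \<theta>"
  define R where "R = V - {u, v}"
  define S where "S = R \<inter> ((N u - N v) \<union> (N v - N u))"
  define X where "X = (\<Prod>w\<in>V. cos (a u w - a v w))"
  define Y where "Y = (\<Prod>w\<in>V. cos (a u w + a v w))"
  define c where "c = card (N u \<inter> N v)"
  have v: "v \<in> V" "u \<noteq> v" using uv nin N by auto
  have finN: "finite (N u)" "finite (N v)" using N fin finite_subset by blast+
  have \<theta>1: "\<theta>\<^sup>2 \<le> (1 / 2)\<^sup>2" using \<theta> by (intro power_mono) auto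
  have split: "prod f V = f u * f v * prod f R" for f :: "_ \<Rightarrow> real"
    using uv v fin prod.subset_diff[of "{u, v}" V f] by (simp add: R_def mult_ac)
  have prS: "(\<Prod>w\<in>R. if w \<in> S then cos \<theta> else 1) = cos \<theta> ^ card S"
  proof -
    have "R \<inter> {w. w \<in> S} = S" by (auto simp: S_def)
    then show ?thesis using fin by (subst prod.If_cases) (auto simp: R_def)
  qed
  have prT: "(\<Prod>w\<in>R. if w \<in> N u \<inter> N v then cos (2 * \<theta>) else 1) = cos (2 * \<theta>) ^ c"
  proof -
    have "R \<inter> {w. w \<in> N u \<inter> N v} = N u \<inter> N v" using N nin by (auto simp: R_def)
    then show ?thesis using fin by (subst prod.If_cases) (auto simp: R_def c_def)
  qed
  \<comment> \<open>A vertex in exactly one of the two sets gives \<open>cos \<theta>\<close> in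
    both products. In a common one the coefficients cancel in \<open>X\<close> and add up to
    \<open>- 2 * \<theta>\<close> in \<open>Y\<close>.\<close>
  have R1: "(\<Prod>w\<in>R. cos (a u w - a v w)) = cos \<theta> ^ card S"
    unfolding prS[symmetric]
    by (intro prod.cong) (auto simp: a_def perturbed_coeff_def R_def S_def)
  have R2: "(\<Prod>w\<in>R. cos (a u w + a v w)) = cos \<theta> ^ card S * cos (2 * \<theta>) ^ c"
    unfolding prS[symmetric] prT[symmetric] prod.distrib[symmetric]
    by (intro prod.cong) (auto simp: a_def perturbed_coeff_def R_def S_def)
  define P where "P = cos \<theta> ^ card S"
  define Q where "Q = cos (2 * \<theta>) ^ c"
  have X: "X = cos (pi / 4) * cos (pi / 4 + \<theta>) * P"
    unfolding X_def split R1 P_def using v uv nin cos_minus[of "pi/4 + \<theta>"]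
    by (simp add: a_def perturbed_coeff_def algebra_simps)
  have Y: "Y = cos (pi / 4) * cos (pi / 4 - \<theta>) * (P * Q)"
    unfolding Y_def split R2 P_def Q_def using v uv nin
    by (simp add: a_def perturbed_coeff_def algebra_simps)
  have cS: "card S \<le> 2 * D"
  proof -
    have "card S \<le> card (N u \<union> N v)" using finN by (intro card_mono) (auto simp: S_def)
    also have "\<dots> \<le> card (N u) + card (N v)" by (rule card_Un_le)
    finally have "real (card S) \<le> real (card (N u)) + real (card (N v))" by linarith
    then show ?thesis using D by simp
  qed
  have P: "1 / 2 \<le> P" "P \<le> 1"
  proof -
    have "1 - card S * \<theta>\<^sup>2 / 2 \<le> P"
      unfolding P_def using \<theta>1 by (intro power_cos_ge) (simp add: power2_eq_square)
    moreover have "card S * \<theta>\<^sup>2 \<le> 2 * D * \<theta>\<^sup>2" using cS by (intro mult_right_mono) auto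
    ultimately show "1 / 2 \<le> P" using \<theta>(3) by simp
    have "0 \<le> cos \<theta>" using cos_ge_one_minus_square[of \<theta>] \<theta>1 by (simp add: power2_eq_square)
    then show "P \<le> 1" unfolding P_def by (intro power_le_one) auto
  qed
  have Q: "1 - 2 * real c * \<theta>\<^sup>2 \<le> Q" "Q \<le> 1"
  proof -
    have *: "(2 * \<theta>)\<^sup>2 \<le> 1" using \<theta>1 by (simp add: power2_eq_square)
    from power_cos_ge[OF this, of c] show "1 - 2 * real c * \<theta>\<^sup>2 \<le> Q"
      by (simp add: Q_def power_mult_distrib)
    have "0 \<le> cos (2 * \<theta>)" using cos_ge_one_minus_square[of "2 * \<theta>"] * by linarith
    then show "Q \<le> 1" unfolding Q_def by (intro power_le_one) auto
  qed
  define k where "k = cos (pi / 4) * cos (pi / 4 - \<theta>)"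
  have k1: "k \<le> 1"
  proof -
    have "\<bar>k\<bar> \<le> 1 * 1" unfolding k_def abs_mult by (intro mult_mono) auto
    then show ?thesis by simp
  qed
  \<comment> \<open>The gain from the edge: the two cosines differ by
    \<open>2 * sin (pi / 4) * sin \<theta>\<close>, and
    \<open>2 * sin (pi / 4) * cos (pi / 4) = 1\<close>.\<close>
  have "cos (pi / 4) * cos (pi / 4 + \<theta>) = k - sin \<theta>"
  proof -
    show ?thesis unfolding k_def cos_add cos_diff cos_45 sin_45 by (simp add: field_simps)
  qed
  then have "X = (k - sin \<theta>) * P" "Y = k * (P * Q)"
    using X Y by (simp_all only: k_def)
  then have XY: "X - Y = P * (k * (1 - Q) - sin \<theta>)"
    by (simp add: algebra_simps)
  have s: "\<theta> / 2 \<le> sin \<theta>" using \<theta> by (intro half_le_sin) auto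
  have "k * (1 - Q) \<le> 1 * (1 - Q)" using k1 Q by (intro mult_right_mono) auto
  also have "1 * (1 - Q) \<le> 2 * real c * \<theta>\<^sup>2" using Q by simp
  finally have kQ: "k * (1 - Q) \<le> 2 * real c * \<theta>\<^sup>2" .
  have "P * (k * (1 - Q) - sin \<theta>) \<le> P * (2 * real c * \<theta>\<^sup>2) - P * (\<theta> / 2)"
    unfolding right_diff_distrib[symmetric] using kQ s P by (intro mult_left_mono) auto
  \<comment> \<open>The loss is bounded with \<open>P \<le> 1\<close>, the gain with
    \<open>P \<ge> 1 / 2\<close>.\<close>
  also have "\<dots> \<le> 1 * (2 * real c * \<theta>\<^sup>2) - 1 / 2 * (\<theta> / 2)"
    using P \<theta> by (intro diff_mono mult_right_mono) auto
  finally have XYle: "(X - Y) / 2 \<le> \<theta>\<^sup>2 * c - \<theta> / 8" unfolding XY by (simp add: mult_ac)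
  have "perturbed_sign V N \<theta> s u * perturbed_sign V N \<theta> s v =
      (cos (\<Sum>w\<in>V. (a u w - a v w) * s w) - cos (\<Sum>w\<in>V. (a u w + a v w) * s w)) / 2" for s
    unfolding perturbed_sign_def a_def sin_times_sin
    by (simp add: sum.distrib sum_subtractf ring_distribs)
  then have "(\<Sum>s\<in>V \<rightarrow>\<^sub>E {-1, 1}. perturbed_sign V N \<theta> s u * perturbed_sign V N \<theta> s v)
      = 2 ^ card V * ((X - Y) / 2)"
    unfolding X_def Y_def
    by (simp only: sum_subtractf sum_signs_cos[OF fin] right_diff_distrib diff_divide_distrib
        flip: sum_divide_distrib)
  also have "\<dots> \<le> 2 ^ card V * (\<theta>\<^sup>2 * c - \<theta> / 8)"
    using XYle by (intro mult_left_mono) auto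
  finally show ?thesis by (simp add: c_def)
qed

subsection \<open>Degenerate orderings\<close>

definition induced_subgraph :: "'a ugraph \<Rightarrow> 'a set \<Rightarrow> 'a ugraph" where
  "induced_subgraph G S = (S, {e \<in> edges G. e \<subseteq> S})"

lemma induced_subgraph_sel [simp]:
  "verts (induced_subgraph G S) = S"
  "edges (induced_subgraph G S) = {e \<in> edges G. e \<subseteq> S}"
  by (simp_all add: induced_subgraph_def)

lemma simple_graph_induced_subgraph:
  "simple_graph G \<Longrightarrow> S \<subseteq> verts G \<Longrightarrow> simple_graph (induced_subgraph G S)"
  by (auto simp: simple_graph_def intro: finite_subset)

lemma simple_graph_edge_neq: "simple_graph G \<Longrightarrow> {v, w} \<in> edges G \<Longrightarrow> v \<noteq> w"
  unfolding simple_graph_def by force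

text \<open>A vertex ordering is encoded by a rank function \<open>r\<close>, taken injective on the
  vertices where it matters.\<close>

definition back_nbrs :: "'a ugraph \<Rightarrow> ('a \<Rightarrow> nat) \<Rightarrow> 'a \<Rightarrow> 'a set" where
  "back_nbrs G r v = {w \<in> verts G. {v, w} \<in> edges G \<and> r w < r v}"

lemma back_nbrs_subset: "back_nbrs G r v \<subseteq> verts G"
  by (auto simp: back_nbrs_def)

text \<open>Each edge has exactly one end of larger rank, so edges correspond to pairs of a vertex
  and one of its earlier neighbours.\<close>

lemma sum_edges_back_nbrs:
  assumes G: "simple_graph G" and r: "inj_on r (verts G)"
  shows "(\<Sum>e\<in>edges G. f e) = (\<Sum>v\<in>verts G. \<Sum>w\<in>back_nbrs G r v. f {v, w})"
proof -
  have fin: "finite (verts G)" using G by (simp add: simple_graph_def)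
  have "bij_betw (\<lambda>(v, w). {v, w}) (SIGMA v:verts G. back_nbrs G r v) (edges G)"
  proof (rule bij_betw_imageI)
    show "inj_on (\<lambda>(v, w). {v, w}) (SIGMA v:verts G. back_nbrs G r v)"
      by (auto simp: inj_on_def back_nbrs_def doubleton_eq_iff)
    show "(\<lambda>(v, w). {v, w}) ` (SIGMA v:verts G. back_nbrs G r v) = edges G"
    proof (intro equalityI subsetI)
      fix e assume e: "e \<in> edges G"
      then obtain a b where ab: "e = {a, b}" "a \<noteq> b"
        using G unfolding simple_graph_def by (meson card_2_iff)
      have V: "a \<in> verts G" "b \<in> verts G" using e G ab unfolding simple_graph_def by auto
      then have "r a \<noteq> r b" using r ab by (auto dest: inj_onD)
      then have "b \<in> back_nbrs G r a \<or> a \<in> back_nbrs G r b"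
        using V e ab by (auto simp: back_nbrs_def insert_commute)
      then show "e \<in> (\<lambda>(v, w). {v, w}) ` (SIGMA v:verts G. back_nbrs G r v)"
        using V ab by (force simp: insert_commute)
    qed (auto simp: back_nbrs_def)
  qed
  from sum.reindex_bij_betw[OF this, of f]
  have "(\<Sum>e\<in>edges G. f e) = (\<Sum>(v, w)\<in>(SIGMA v:verts G. back_nbrs G r v). f {v, w})"
    by (simp add: case_prod_unfold)
  also have "\<dots> = (\<Sum>v\<in>verts G. \<Sum>w\<in>back_nbrs G r v. f {v, w})"
    using fin finite_subset[OF back_nbrs_subset fin] by (intro sum.Sigma[symmetric]) auto
  finally show ?thesis .
qed

lemma sum_card_back_nbrs:
  assumes "simple_graph G" "inj_on r (verts G)"
  shows "(\<Sum>v\<in>verts G. card (back_nbrs G r v)) = card (edges G)"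
  using sum_edges_back_nbrs[OF assms, of "\<lambda>_. 1::nat"] by simp

text \<open>Inside the subgraph induced on the earlier neighbours of \<open>u\<close>, the earlier
  neighbours of \<open>v\<close> are precisely the common ones. The sum therefore counts the edges
  of that subgraph by their later end.\<close>

lemma sum_card_common_back_nbrs:
  assumes G: "simple_graph G" and r: "inj_on r (verts G)"
  shows "(\<Sum>v\<in>back_nbrs G r u. card (back_nbrs G r u \<inter> back_nbrs G r v))
    = card (edges (induced_subgraph G (back_nbrs G r u)))"
proof -
  let ?S = "back_nbrs G r u"
  have "back_nbrs (induced_subgraph G ?S) r v = ?S \<inter> back_nbrs G r v" if "v \<in> ?S" for v
    using that by (auto simp: back_nbrs_def)
  then show ?thesis
    using sum_card_back_nbrs[OF simple_graph_induced_subgraph[OF G back_nbrs_subset[of G r u]], of r]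
      inj_on_subset[OF r back_nbrs_subset] by simp
qed

text \<open>Take a vertex with at most \<open>D\<close> neighbours in the whole set, order the rest
  by induction and put that vertex last.\<close>

lemma degenerate_ordering_aux:
  fixes P :: "'a \<Rightarrow> 'a \<Rightarrow> bool" and D :: real
  assumes "finite V"
    and "\<forall>S. S \<subseteq> V \<longrightarrow> S \<noteq> {} \<longrightarrow> (\<exists>v\<in>S. card {w \<in> S. P v w} \<le> D)"
  shows "\<exists>r :: 'a \<Rightarrow> nat. inj_on r V \<and> (\<forall>v\<in>V. card {w \<in> V. P v w \<and> r w < r v} \<le> D)"
  using assms
proof (induction V rule: finite_psubset_induct)
  case (psubset V)
  show ?case
  proof (cases "V = {}")
    case False
    then obtain v where v: "v \<in> V" "card {w \<in> V. P v w} \<le> D"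
      using psubset.prems by auto
    have "\<exists>r :: 'a \<Rightarrow> nat. inj_on r (V - {v}) \<and>
        (\<forall>u\<in>V - {v}. card {w \<in> V - {v}. P u w \<and> r w < r u} \<le> D)"
      by (rule psubset.IH) (use v psubset.prems in auto)
    then obtain r :: "'a \<Rightarrow> nat" where r: "inj_on r (V - {v})"
        "\<forall>u\<in>V - {v}. card {w \<in> V - {v}. P u w \<and> r w < r u} \<le> D"
      by blast
    \<comment> \<open>One more than the sum of all ranks exceeds each of them, so \<open>v\<close>
      comes last.\<close>
    define r' where "r' = r(v := Suc (\<Sum>w\<in>V. r w))"
    have big: "r w < r' v" if "w \<in> V" for w
      using member_le_sum[OF that, of r] psubset.hyps by (simp add: r'_def)
    have "inj_on r' V"
    proof (rule inj_onI)
      fix x y assume *: "x \<in> V" "y \<in> V" "r' x = r' y"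
      then show "x = y"
        using big[of x] big[of y] r(1) by (auto simp: r'_def inj_on_def split: if_splits)
    qed
    moreover have "card {w \<in> V. P u w \<and> r' w < r' u} \<le> D" if u: "u \<in> V" for u
    proof (cases "u = v")
      case True
      have "card {w \<in> V. P u w \<and> r' w < r' u} \<le> card {w \<in> V. P v w}"
        using True psubset.hyps by (intro card_mono) auto
      then show ?thesis using v(2) by linarith
    next
      case False
      then have "{w \<in> V. P u w \<and> r' w < r' u} = {w \<in> V - {v}. P u w \<and> r w < r u}"
        using big[OF u] by (auto simp: r'_def split: if_splits)
      then show ?thesis using r(2) u False by simp
    qed
    ultimately show ?thesis by (intro exI[of _ r'] conjI ballI)
  qed simp
qed

lemma degenerate_ordering:
  fixes G :: "'a ugraph" and D :: real
  assumes "finite (verts G)"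
    and "\<forall>S. S \<subseteq> verts G \<longrightarrow> S \<noteq> {} \<longrightarrow> (\<exists>v\<in>S. card {w \<in> S. {v, w} \<in> edges G} \<le> D)"
  shows "\<exists>r. inj_on r (verts G) \<and> (\<forall>v\<in>verts G. card (back_nbrs G r v) \<le> D)"
  unfolding back_nbrs_def by (rule degenerate_ordering_aux[OF assms])

lemma sum_degrees:
  assumes G: "simple_graph G"
  shows "(\<Sum>v\<in>verts G. card {w \<in> verts G. {v, w} \<in> edges G}) = 2 * card (edges G)"
proof -
  have "card {w \<in> verts G. {v, w} \<in> edges G} = card {e \<in> edges G. v \<in> e}" for v
  proof (rule bij_betw_same_card[of "\<lambda>w. {v, w}"], rule bij_betw_imageI)
    show "inj_on (\<lambda>w. {v, w}) {w \<in> verts G. {v, w} \<in> edges G}"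
      by (auto simp: inj_on_def doubleton_eq_iff)
    show "(\<lambda>w. {v, w}) ` {w \<in> verts G. {v, w} \<in> edges G} = {e \<in> edges G. v \<in> e}"
    proof (intro equalityI subsetI)
      fix e assume e: "e \<in> {e \<in> edges G. v \<in> e}"
      then have "card e = 2" "e \<subseteq> verts G" using G unfolding simple_graph_def by auto
      then obtain w where "e = {v, w}" "w \<in> verts G"
        using e by (auto simp: card_2_iff)
      then show "e \<in> (\<lambda>w. {v, w}) ` {w \<in> verts G. {v, w} \<in> edges G}" using e by auto
    qed auto
  qed
  then have "(\<Sum>v\<in>verts G. card {w \<in> verts G. {v, w} \<in> edges G})
      = (\<Sum>v\<in>verts G. card {e \<in> edges G. v \<in> e})"
    by simp
  also have "\<dots> = 2 * card (edges G)"
  proof (rule sum_multicount)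
    show "finite (verts G)" "finite (edges G)"
      using G finite_edges[OF G] unfolding simple_graph_def by blast+
    show "\<forall>e\<in>edges G. card {v \<in> verts G. v \<in> e} = 2"
    proof
      fix e assume "e \<in> edges G"
      then have "card e = 2" "{v \<in> verts G. v \<in> e} = e" using G unfolding simple_graph_def by auto
      then show "card {v \<in> verts G. v \<in> e} = 2" by simp
    qed
  qed
  finally show ?thesis .
qed

lemma exists_degree_le_average:
  assumes G: "simple_graph G" and "verts G \<noteq> {}"
  shows "\<exists>v\<in>verts G. real (card {w \<in> verts G. {v, w} \<in> edges G})
    \<le> 2 * card (edges G) / card (verts G)"
proof (rule ccontr)
  let ?d = "2 * real (card (edges G)) / card (verts G)"
  assume "\<not> ?thesis"
  then have less: "\<And>v. v \<in> verts G \<Longrightarrow> ?d < card {w \<in> verts G. {v, w} \<in> edges G}"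
    by (auto simp: not_le)
  have fin: "finite (verts G)" using G by (simp add: simple_graph_def)
  have "(\<Sum>v\<in>verts G. ?d) < (\<Sum>v\<in>verts G. real (card {w \<in> verts G. {v, w} \<in> edges G}))"
    using fin assms less by (intro sum_strict_mono) auto
  also have "\<dots> = 2 * card (edges G)"
    using arg_cong[OF sum_degrees[OF G], of real] by simp
  finally show False using fin assms by (simp add: card_gt_0_iff)
qed

subsection \<open>Surplus of degenerate graphs\<close>

text \<open>Averaging the rounded cut over all sign vectors gains order \<open>\<theta>\<close> per
  edge and loses \<open>\<theta>\<^sup>2\<close> per edge inside a set of earlier neighbours.
  Sparsity of these sets bounds the total loss by
  \<open>\<theta>\<^sup>2 * C * D powr \<gamma>\<close> times the number of edges.\<close>

lemma surplus_ge_of_sparse_back_nbrs: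
  fixes G :: "'a ugraph" and C D \<gamma> :: real
  assumes G: "simple_graph G" and r: "inj_on r (verts G)"
    and C: "C \<ge> 1" and D: "D \<ge> 1" and \<gamma>: "\<gamma> \<ge> 1 / 2"
    and deg: "\<And>v. v \<in> verts G \<Longrightarrow> card (back_nbrs G r v) \<le> D"
    and sparse: "\<And>v. v \<in> verts G \<Longrightarrow> card (edges (induced_subgraph G (back_nbrs G r v)))
       \<le> C * card (back_nbrs G r v) powr (1 + \<gamma>)"
  shows "surplus G \<ge> card (edges G) / (512 * C * D powr \<gamma>)"
proof -
  define V where "V = verts G"
  define N where "N = back_nbrs G r"
  define m where "m = real (card (edges G))"
  \<comment> \<open>With this value the loss is \<open>\<theta> * m / 16\<close>, half of the gain
    \<open>\<theta> * m / 8\<close>.\<close>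
  define \<theta> where "\<theta> = 1 / (16 * C * D powr \<gamma>)"
  define \<Omega> where "\<Omega> = V \<rightarrow>\<^sub>E {-1, 1 :: real}"
  have fin: "finite V" using G by (simp add: simple_graph_def V_def)
  have D\<gamma>: "D powr \<gamma> \<ge> 1" using D \<gamma> by (intro ge_one_powr_ge_zero) auto
  then have CD: "C * D powr \<gamma> \<ge> 1" using C mult_mono[of 1 C 1 "D powr \<gamma>"] by simp
  then have \<theta>: "0 < \<theta>" "\<theta> \<le> 1 / 2" unfolding \<theta>_def by (auto simp: field_simps)
  have \<theta>CD: "\<theta> * (C * D powr \<gamma>) = 1 / 16" using C D by (simp add: \<theta>_def field_simps)
  have D\<theta>: "D * \<theta>\<^sup>2 \<le> 1 / 2"
  proof -
    \<comment> \<open>Here \<open>\<gamma> \<ge> 1 / 2\<close> makes \<open>\<theta>\<close> small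
      enough to keep the damping factor bounded below.\<close>
    have "D powr 1 \<le> D powr (2 * \<gamma>)" using D \<gamma> by (intro powr_mono) auto
    also have "\<dots> = (D powr \<gamma>)\<^sup>2" using D by (simp add: powr_powr mult.commute flip: powr_numeral)
    also have "\<dots> \<le> (C * D powr \<gamma>)\<^sup>2" using C D\<gamma> mult_right_mono[of 1 C "D powr \<gamma>"] by (intro power_mono) auto
    finally have "D * \<theta>\<^sup>2 \<le> (C * D powr \<gamma>)\<^sup>2 * \<theta>\<^sup>2" using D by (intro mult_right_mono) auto
    also have "\<dots> = (\<theta> * (C * D powr \<gamma>))\<^sup>2" by (simp add: power_mult_distrib)
    also have "\<dots> \<le> 1 / 2" unfolding \<theta>CD by (simp add: power_divide)
    finally show ?thesis .
  qed
  have card_\<Omega>: "card \<Omega> = 2 ^ card V" using fin by (simp add: \<Omega>_def card_PiE numeral_2_eq_2)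
  have NV: "N v \<subseteq> V" for v unfolding N_def V_def by (rule back_nbrs_subset)
  have T: "(\<Sum>u\<in>V. \<Sum>v\<in>N u. real (card (N u \<inter> N v))) \<le> C * D powr \<gamma> * m"
  proof -
    have "(\<Sum>v\<in>N u. real (card (N u \<inter> N v))) \<le> C * D powr \<gamma> * card (N u)" if u: "u \<in> V" for u
    proof -
      have "(\<Sum>v\<in>N u. real (card (N u \<inter> N v))) = card (edges (induced_subgraph G (N u)))"
        using sum_card_common_back_nbrs[OF G r, of u] unfolding N_def by (simp flip: of_nat_sum)
      also have "\<dots> \<le> C * card (N u) powr (1 + \<gamma>)" using sparse u by (simp add: V_def N_def)
      also have "\<dots> = C * (card (N u) * card (N u) powr \<gamma>)" by (simp add: powr_add)
      \<comment> \<open>One factor \<open>card (N u)\<close> is kept, since these sizes add up to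
        \<open>m\<close>.\<close>
      also have "\<dots> \<le> C * (card (N u) * D powr \<gamma>)"
        using C deg u \<gamma> by (intro mult_left_mono powr_mono2) (auto simp: V_def N_def)
      finally show ?thesis by (simp add: mult_ac)
    qed
    then have "(\<Sum>u\<in>V. \<Sum>v\<in>N u. real (card (N u \<inter> N v))) \<le> (\<Sum>u\<in>V. C * D powr \<gamma> * card (N u))"
      by (rule sum_mono)
    also have "\<dots> = C * D powr \<gamma> * m"
      using sum_card_back_nbrs[OF G r]
      by (simp add: m_def V_def N_def flip: sum_distrib_left of_nat_sum)
    finally show ?thesis .
  qed
  let ?y = "perturbed_sign V N \<theta>"
  have "2 ^ card V * (- 2 * surplus G) = (\<Sum>s\<in>\<Omega>. - 2 * surplus G)"
    by (simp add: card_\<Omega>)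
  also have "\<dots> \<le> (\<Sum>s\<in>\<Omega>. \<Sum>e\<in>edges G. \<Prod>v\<in>e. ?y s v)"
  proof (rule sum_mono)
    fix s
    have "surplus G \<ge> - (\<Sum>e\<in>edges G. \<Prod>v\<in>e. ?y s v) / 2"
      by (rule surplus_ge_edge_correlation[OF G]) (simp add: perturbed_sign_def)
    then show "- 2 * surplus G \<le> (\<Sum>e\<in>edges G. \<Prod>v\<in>e. ?y s v)"
      by simp
  qed
  also have "\<dots> = (\<Sum>e\<in>edges G. \<Sum>s\<in>\<Omega>. \<Prod>v\<in>e. ?y s v)"
    by (rule sum.swap)
  also have "\<dots> = (\<Sum>u\<in>V. \<Sum>v\<in>N u. \<Sum>s\<in>\<Omega>. \<Prod>w\<in>{u, v}. ?y s w)"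
    unfolding V_def N_def by (rule sum_edges_back_nbrs[OF G r])
  also have "\<dots> \<le> (\<Sum>u\<in>V. \<Sum>v\<in>N u. 2 ^ card V * (\<theta>\<^sup>2 * card (N u \<inter> N v) - \<theta> / 8))"
  proof (intro sum_mono)
    fix u v assume uv: "u \<in> V" "v \<in> N u"
    have "v \<in> V" "u \<noteq> v" "u \<notin> N u" "v \<notin> N v" "u \<notin> N v"
      using uv NV by (auto simp: N_def back_nbrs_def)
    then show "(\<Sum>s\<in>\<Omega>. \<Prod>w\<in>{u, v}. ?y s w) \<le> 2 ^ card V * (\<theta>\<^sup>2 * card (N u \<inter> N v) - \<theta> / 8)"
      using sum_perturbed_sign_mult[of V N u v D \<theta>, OF fin NV NV uv] deg uv \<theta> D\<theta>
      unfolding \<Omega>_def by (simp add: V_def N_def)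
  qed
  also have "\<dots> = 2 ^ card V * (\<theta>\<^sup>2 * (\<Sum>u\<in>V. \<Sum>v\<in>N u. real (card (N u \<inter> N v))) - \<theta> / 8 * m)"
  proof -
    have "(\<Sum>u\<in>V. \<Sum>v\<in>N u. \<theta> / 8) = \<theta> / 8 * real (\<Sum>u\<in>V. card (N u))"
      by (simp add: sum_distrib_left mult.commute)
    also have "(\<Sum>u\<in>V. card (N u)) = card (edges G)"
      unfolding V_def N_def by (rule sum_card_back_nbrs[OF G r])
    finally have "(\<Sum>u\<in>V. \<Sum>v\<in>N u. \<theta> / 8) = \<theta> / 8 * m"
      unfolding m_def .
    then show ?thesis
      by (simp only: sum_subtractf flip: sum_distrib_left)
  qed
  also have "\<dots> \<le> 2 ^ card V * (\<theta>\<^sup>2 * (C * D powr \<gamma> * m) - \<theta> / 8 * m)"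
    using T by (intro mult_left_mono diff_right_mono) auto
  also have "\<theta>\<^sup>2 * (C * D powr \<gamma> * m) = \<theta> * (\<theta> * (C * D powr \<gamma>)) * m"
    by (simp add: power2_eq_square mult_ac)
  finally have "- 2 * surplus G \<le> \<theta> * (1 / 16) * m - \<theta> / 8 * m"
    unfolding \<theta>CD by simp
  then have "surplus G \<ge> \<theta> * m / 32" by simp
  then show ?thesis by (simp add: \<theta>_def m_def)
qed

subsection \<open>Forbidden subgraphs\<close>

lemma card_edges_le_power:
  assumes "simple_graph G"
  shows "card (edges G) \<le> 2 ^ card (verts G)"
proof -
  have "card (edges G) \<le> card (Pow (verts G))"
    using assms by (intro card_mono) (auto simp: simple_graph_def)
  then show ?thesis using assms by (simp add: card_Pow simple_graph_def)
qed

lemma card_edges_le_ex_number: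
  fixes G :: "nat ugraph"
  assumes "simple_graph G" "free_of F G"
  shows "card (edges G) \<le> ex_number (card (verts G)) F"
  unfolding ex_number_def using assms
  by (intro Max_ge[OF finite_ex_number_values] CollectI exI[of _ G]) simp

text \<open>Makes the asymptotic bound uniform: the finitely many orders below \<open>n0\<close> are
  absorbed into the constant through the trivial bound \<open>2 ^ n0\<close>. Order 0 is separate,
  as \<open>0 powr p = 0\<close> demands that there be no edges.\<close>

lemma card_edges_le_powr_if_ex_number_bigo:
  assumes ex: "(\<lambda>n. real (ex_number n F)) \<in> O(\<lambda>n. real n powr p)" and p: "p \<ge> 0"
  obtains C where "C \<ge> 1" "\<And>G :: nat ugraph. simple_graph G \<Longrightarrow> free_of F G \<Longrightarrow>
    card (edges G) \<le> C * card (verts G) powr p"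
proof -
  obtain c where c: "c > 0" "eventually (\<lambda>n. norm (real (ex_number n F)) \<le> c * norm (real n powr p)) at_top"
    using ex by (rule landau_o.bigE)
  then obtain n0 where n0: "\<And>n. n \<ge> n0 \<Longrightarrow> real (ex_number n F) \<le> c * real n powr p"
    by (auto simp: eventually_at_top_linorder)
  define K where "K = max c (2 ^ n0)"
  have K: "K \<ge> 1" "K \<ge> c" "K \<ge> 2 ^ n0" by (auto simp: K_def le_max_iff_disj)
  show ?thesis
  proof (rule that[OF K(1)])
    fix G :: "nat ugraph"
    assume G: "simple_graph G" "free_of F G"
    define n where "n = card (verts G)"
    have "real (card (edges G)) \<le> K * real n powr p"
    proof (cases "n \<ge> n0")
      case True
      have "real (card (edges G)) \<le> ex_number n F"
        using card_edges_le_ex_number[OF G] by (simp add: n_def)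
      also have "\<dots> \<le> c * real n powr p" by (rule n0[OF True])
      also have "\<dots> \<le> K * real n powr p" using K(2) by (intro mult_right_mono) auto
      finally show ?thesis .
    next
      case False
      show ?thesis
      proof (cases "n = 0")
        case True
        then have "verts G = {}" using G(1) by (simp add: n_def simple_graph_def)
        then have "edges G = {}" using G(1) unfolding simple_graph_def by fastforce
        then show ?thesis using K(1) by simp
      next
        case n: False
        have "card (edges G) \<le> 2 ^ n"
          using card_edges_le_power[OF G(1)] by (simp add: n_def)
        then have "real (card (edges G)) \<le> real (2 ^ n)" by (rule of_nat_mono)
        also have "real (2 ^ n) = 2 ^ n" by simp
        also have "\<dots> \<le> 2 ^ n0" using False by (intro power_increasing) auto
        also have "\<dots> \<le> K * 1" using K(3) by simp
        also have "\<dots> \<le> K * real n powr p"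
          using n p K(1) by (intro mult_left_mono ge_one_powr_ge_zero) auto
        finally show ?thesis .
      qed
    qed
    then show "card (edges G) \<le> K * card (verts G) powr p" by (simp add: n_def)
  qed
qed

lemma contains_copy_mono:
  assumes "contains_copy G H" "verts G \<subseteq> verts G'" "edges G \<subseteq> edges G'"
  shows "contains_copy G' H"
proof -
  obtain f where "inj_on f (verts H)" "f ` verts H \<subseteq> verts G" "\<forall>e\<in>edges H. f ` e \<in> edges G"
    using assms(1) unfolding contains_copy_def by (elim exE conjE)
  then show ?thesis
    unfolding contains_copy_def using assms(2,3) by (intro exI[of _ f]) auto
qed

lemma free_of_subgraph:
  "free_of H G' \<Longrightarrow> verts G \<subseteq> verts G' \<Longrightarrow> edges G \<subseteq> edges G' \<Longrightarrow> free_of H G"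
  using contains_copy_mono unfolding free_of_def by metis

lemma contains_copy_delete_vertex:
  assumes "contains_copy G H"
  shows "contains_copy G (delete_vertex H v)"
proof -
  obtain f where "inj_on f (verts H)" "f ` verts H \<subseteq> verts G" "\<forall>e\<in>edges H. f ` e \<in> edges G"
    using assms unfolding contains_copy_def by (elim exE conjE)
  then show ?thesis
    unfolding contains_copy_def delete_vertex_def
    by (intro exI[of _ f]) (auto intro: inj_on_subset)
qed

lemma free_of_if_free_of_delete_vertex: "free_of (delete_vertex H v) G \<Longrightarrow> free_of H G"
  using contains_copy_delete_vertex unfolding free_of_def by metis

text \<open>A copy of \<open>H\<close> minus \<open>v\<close> among neighbours of \<open>u\<close>
  extends to a copy of \<open>H\<close> by sending \<open>v\<close> to \<open>u\<close>; injectivity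
  follows from \<open>u \<notin> S\<close>.\<close>

lemma nbrs_free_of_delete_vertex:
  assumes H: "simple_graph H" and v: "v \<in> verts H" and free: "free_of H G"
    and u: "u \<in> verts G" "u \<notin> S" and S: "S \<subseteq> verts G" "\<And>w. w \<in> S \<Longrightarrow> {u, w} \<in> edges G"
  shows "free_of (delete_vertex H v) (induced_subgraph G S)"
proof -
  have False if "contains_copy (induced_subgraph G S) (delete_vertex H v)"
  proof -
    from that obtain f where f: "inj_on f (verts H - {v})" "f ` (verts H - {v}) \<subseteq> S"
        "\<And>e. e \<in> edges H \<Longrightarrow> v \<notin> e \<Longrightarrow> f ` e \<in> edges G"
      unfolding contains_copy_def delete_vertex_def by (elim exE conjE) simp
    define g where "g = f(v := u)"
    have inj: "inj_on g (verts H)"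
      using f(1,2) u by (auto simp: inj_on_def g_def image_subset_iff)
    have im: "g ` verts H \<subseteq> verts G" using f(2) u S by (auto simp: g_def)
    have "g ` e \<in> edges G" if e: "e \<in> edges H" for e
    proof (cases "v \<in> e")
      case True
      have "card e = 2" "e \<subseteq> verts H" using H e by (auto simp: simple_graph_def)
      then obtain w where w: "e = {v, w}" "w \<noteq> v" "w \<in> verts H"
        using True by (auto simp: card_2_iff)
      then have "g ` e = {u, f w}" "f w \<in> S" using f(2) by (auto simp: g_def)
      then show ?thesis using S(2) by simp
    next
      case False
      then have "g ` e = f ` e" by (auto simp: g_def)
      then show ?thesis using f(3)[OF e False] by simp
    qed
    with inj im have "contains_copy G H"
      unfolding contains_copy_def by (intro exI[of _ g] conjI ballI)
    then show False using free by (simp add: free_of_def)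
  qed
  then show ?thesis unfolding free_of_def by blast
qed

text \<open>Ensures that a minimum over free graphs with \<open>m\<close> edges ranges over a
  nonempty set. The extremal number is unbounded, so some free graph has more than \<open>m\<close>
  edges, and surplus edges can be deleted.\<close>

lemma exists_free_graph_with_edges:
  assumes ex: "(\<lambda>n. real (ex_number n F)) \<in> \<Omega>(\<lambda>n. real n powr p)" and p: "p \<ge> 1"
  shows "\<exists>G :: nat ugraph. simple_graph G \<and> card (edges G) = m \<and> free_of F G"
proof -
  \<comment> \<open>If no free graph on \<open>n\<close> vertices existed,
    \<open>ex_number n F\<close> would be the unspecified \<open>Max {}\<close>; exceeding
    \<open>K\<close> rules this out.\<close>
  define K where "K = max m (Max {})"
  obtain c where c: "c > 0" "eventually (\<lambda>n. norm (real (ex_number n F)) \<ge> c * norm (real n powr p)) at_top"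
    using ex by (rule landau_omega.bigE)
  have "eventually (\<lambda>n. real n > real K / c) sequentially"
    using filterlim_real_sequentially by (simp add: filterlim_at_top_dense)
  with c(2) have "eventually (\<lambda>n. ex_number n F > K) sequentially"
  proof eventually_elim
    case (elim n)
    have "0 \<le> real K / c" using c(1) by simp
    then have n: "real n > 0" using elim(2) by linarith
    have "real K < c * real n" using elim(2) c(1) by (simp add: field_simps)
    also have "\<dots> = c * real n powr 1" using n by simp
    also have "\<dots> \<le> c * real n powr p"
      using n c(1) p by (intro mult_left_mono powr_mono) auto
    also have "\<dots> \<le> ex_number n F" using elim(1) by simp
    finally show ?case by simp
  qed
  then obtain n where n: "ex_number n F > K"
    using eventually_happens'[OF sequentially_bot] by auto
  let ?A = "{card (edges G) | G :: nat ugraph. simple_graph G \<and> card (verts G) = n \<and> free_of F G}"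
  have "?A \<noteq> {}"
  proof
    assume *: "?A = {}"
    have "ex_number n F = Max {}" unfolding ex_number_def * ..
    then show False using n by (simp add: K_def)
  qed
  then have "ex_number n F \<in> ?A"
    unfolding ex_number_def by (intro Max_in finite_ex_number_values)
  then obtain G :: "nat ugraph" where G: "simple_graph G" "free_of F G" "card (edges G) > m"
    using n by (auto simp: K_def)
  then obtain E where E: "E \<subseteq> edges G" "card E = m"
    using obtain_subset_with_card_n[of m "edges G"] by auto
  have "simple_graph (verts G, E)" using G E by (auto simp: simple_graph_def)
  moreover have "free_of F (verts G, E)" using free_of_subgraph[OF G(2)] E by simp
  ultimately show ?thesis using E by (intro exI[of _ "(verts G, E)"]) simp
qed

section \<open>Degeneracy and surplus of \<open>H\<close>-free graphs\<close>

text \<open>For \<open>e\<close> edges and \<open>n\<close> vertices, the first bound gives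
  \<open>e powr (1 / p) \<le> C * n\<close>, so \<open>e / n\<close> is at most
  \<open>C * e powr (1 - 1 / p)\<close>. The minimum degree is at most the average
  \<open>2 * e / n\<close>.\<close>

lemma min_degree_le_powr:
  fixes G :: "'a ugraph" and C p :: real
  assumes G: "simple_graph G" and ne: "verts G \<noteq> {}" and p: "p > 1" and C: "C \<ge> 1"
    and le: "card (edges G) \<le> C * card (verts G) powr p" "card (edges G) \<le> m"
  shows "\<exists>v\<in>verts G. card {w \<in> verts G. {v, w} \<in> edges G} \<le> 2 * C * real m powr (1 - 1 / p)"
proof -
  define n where "n = real (card (verts G))"
  define e where "e = real (card (edges G))"
  have n: "n > 0" using G ne by (simp add: n_def simple_graph_def card_gt_0_iff)
  have "e / n \<le> C * real m powr (1 - 1 / p)"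
  proof (cases "e = 0")
    case False
    then have e: "e > 0" by (simp add: e_def)
    have "e powr (1 / p) \<le> (C * n powr p) powr (1 / p)"
      using le(1) p e by (intro powr_mono2) (auto simp: e_def n_def)
    also have "\<dots> = C powr (1 / p) * n" using p n C by (simp add: powr_mult powr_powr)
    also have "\<dots> \<le> C powr 1 * n" using p C n by (intro mult_right_mono powr_mono) auto
    finally have *: "e powr (1 / p) \<le> C * n" using C by simp
    have "e = e powr (1 - 1 / p) * e powr (1 / p)" using e by (simp flip: powr_add)
    also have "\<dots> \<le> real m powr (1 - 1 / p) * (C * n)"
      using * le(2) p by (intro mult_mono powr_mono2) (auto simp: e_def)
    finally show ?thesis using n by (simp add: field_simps)
  qed (use C in simp)
  moreover obtain v where "v \<in> verts G" "real (card {w \<in> verts G. {v, w} \<in> edges G}) \<le> 2 * (e / n)"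
    using exists_degree_le_average[OF G ne] by (auto simp: e_def n_def)
  ultimately show ?thesis by (intro bexI[of _ v]) auto
qed

text \<open>Every induced subgraph is again \<open>H\<close>-free with at most \<open>m\<close>
  edges, so the bound on the minimum degree yields a degenerate ordering. The earlier neighbours of
  a vertex span a graph free of \<open>delete_vertex H v\<close>, hence a sparse one.\<close>

lemma surplus_ge_if_locally_free:
  fixes H :: "'a ugraph" and \<gamma> p :: real
  assumes H: "simple_graph H" and v: "v \<in> verts H"
    and p: "p > 1" and \<gamma>: "\<gamma> \<ge> 1 / 2"
    and exH: "(\<lambda>n. real (ex_number n H)) \<in> O(\<lambda>n. real n powr p)"
    and exB: "(\<lambda>n. real (ex_number n (delete_vertex H v))) \<in> O(\<lambda>n. real n powr (1 + \<gamma>))"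
  obtains c where "c > 0" "\<And>G :: nat ugraph. simple_graph G \<Longrightarrow> free_of H G \<Longrightarrow> edges G \<noteq> {} \<Longrightarrow>
    surplus G \<ge> c * real (card (edges G)) powr (1 - (1 - 1 / p) * \<gamma>)"
proof -
  obtain C where C: "C \<ge> 1" and CH: "\<And>G :: nat ugraph. simple_graph G \<Longrightarrow> free_of H G \<Longrightarrow>
      card (edges G) \<le> C * card (verts G) powr p"
    using card_edges_le_powr_if_ex_number_bigo[OF exH] p by auto
  obtain C' where C': "C' \<ge> 1" and CB: "\<And>G :: nat ugraph. simple_graph G \<Longrightarrow>
      free_of (delete_vertex H v) G \<Longrightarrow> card (edges G) \<le> C' * card (verts G) powr (1 + \<gamma>)"
    using card_edges_le_powr_if_ex_number_bigo[OF exB] \<gamma> by auto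
  \<comment> \<open>The constant left after inserting \<open>D = 2 * C * m powr (1 - 1 / p)\<close>
    into the surplus bound.\<close>
  define c where "c = 1 / (512 * C' * (2 * C) powr \<gamma>)"
  show ?thesis
  proof (rule that[of c])
    show "c > 0" using C C' by (simp add: c_def)
    fix G :: "nat ugraph"
    assume G: "simple_graph G" and free: "free_of H G" and ne: "edges G \<noteq> {}"
    define m where "m = card (edges G)"
    define D where "D = 2 * C * real m powr (1 - 1 / p)"
    have m: "m \<ge> 1" using ne finite_edges[OF G] by (simp add: m_def Suc_le_eq card_gt_0_iff)
    have "real m powr (1 - 1 / p) \<ge> 1" using m p by (intro ge_one_powr_ge_zero) auto
    then have D: "D \<ge> 1" using C mult_mono[of 1 C 1 "real m powr (1 - 1 / p)"] by (simp add: D_def)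
    have fin: "finite (verts G)" using G by (simp add: simple_graph_def)
    have deg: "\<exists>w\<in>S. real (card {x \<in> S. {w, x} \<in> edges G}) \<le> D" if S: "S \<subseteq> verts G" "S \<noteq> {}" for S
    proof -
      let ?G = "induced_subgraph G S"
      have GS: "simple_graph ?G" by (rule simple_graph_induced_subgraph[OF G S(1)])
      have "card (edges ?G) \<le> C * card (verts ?G) powr p"
        using free_of_subgraph[OF free, of ?G] S(1) by (intro CH[OF GS]) auto
      moreover have "card (edges ?G) \<le> m"
        unfolding m_def by (intro card_mono finite_edges[OF G]) auto
      ultimately obtain w where w: "w \<in> S" "real (card {x \<in> S. {w, x} \<in> edges ?G}) \<le> D"
        using min_degree_le_powr[OF GS _ p C] S(2) by (auto simp: D_def)
      have "{x \<in> S. {w, x} \<in> edges ?G} = {x \<in> S. {w, x} \<in> edges G}" using w(1) by auto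
      then show ?thesis using w by auto
    qed
    have "\<exists>r. inj_on r (verts G) \<and> (\<forall>w\<in>verts G. card (back_nbrs G r w) \<le> D)"
      using deg by (intro degenerate_ordering[OF fin] allI impI)
    then obtain r where r: "inj_on r (verts G)" "\<forall>w\<in>verts G. card (back_nbrs G r w) \<le> D"
      by (elim exE conjE)
    have "surplus G \<ge> card (edges G) / (512 * C' * D powr \<gamma>)"
    proof (rule surplus_ge_of_sparse_back_nbrs[OF G r(1) C' D \<gamma> r(2)[rule_format]])
      fix w assume w: "w \<in> verts G"
      have "free_of (delete_vertex H v) (induced_subgraph G (back_nbrs G r w))"
        by (rule nbrs_free_of_delete_vertex[OF H v free w]) (auto simp: back_nbrs_def)
      then show "card (edges (induced_subgraph G (back_nbrs G r w)))
          \<le> C' * card (back_nbrs G r w) powr (1 + \<gamma>)"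
        using CB[OF simple_graph_induced_subgraph[OF G back_nbrs_subset]] by simp
    qed
    also have "card (edges G) / (512 * C' * D powr \<gamma>) = c * (m / m powr ((1 - 1 / p) * \<gamma>))"
      using C by (simp add: D_def powr_mult powr_powr c_def m_def)
    also have "m / m powr ((1 - 1 / p) * \<gamma>) = m powr (1 - (1 - 1 / p) * \<gamma>)"
      using m by (simp add: powr_diff)
    finally show "surplus G \<ge> c * real (card (edges G)) powr (1 - (1 - 1 / p) * \<gamma>)"
      by (simp add: m_def)
  qed
qed

section \<open>Comparison of the exponent with 3/4\<close>

theorem theorem2p11:
  fixes \<epsilon> \<alpha> :: real and H :: "'a ugraph"
  assumes "0 < \<epsilon>" and "\<epsilon> \<le> 2 / 5"
    and "\<alpha> > (2 - 4 * \<epsilon>) / (3 - 4 * \<epsilon>)"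
    and "simple_graph H"
    and "(\<lambda>n. real (ex_number n H)) \<in> O(\<lambda>n. real n powr (2 - \<alpha>))"
    and "\<exists>v \<in> verts H. bipartite (delete_vertex H v) \<and>
           (\<lambda>n. real (ex_number n (delete_vertex H v))) \<in> \<Theta>(\<lambda>n. real n powr (2 - \<epsilon>))"
  shows "\<exists>\<epsilon>H > 0. \<exists>C > 0. \<forall>m :: nat. m \<ge> 1 \<longrightarrow>
           sp_min m H \<ge> C * real m powr (3 / 4 + \<epsilon>H)"
proof -
  obtain v where v: "v \<in> verts H"
    and exB: "(\<lambda>n. real (ex_number n (delete_vertex H v))) \<in> \<Theta>(\<lambda>n. real n powr (2 - \<epsilon>))"
    using assms(6) by blast
  \<comment> \<open>The hypotheses force \<open>\<alpha> \<le> \<epsilon>\<close>; lowering \<open>\<alpha>\<close> to at most \<open>5 / 6\<close> secures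
    \<open>p > 1\<close> without having to derive this.\<close>
  define a where "a = min \<alpha> (5 / 6)"
  define p where "p = 2 - a"
  have e3: "3 - 4 * \<epsilon> > 0" using assms by simp
  \<comment> \<open>The threshold equals \<open>1 - 1 / (3 - 4 * \<epsilon>)\<close>, which is below
    2/3, so \<open>a\<close> still exceeds it.\<close>
  have "(2 - 4 * \<epsilon>) / (3 - 4 * \<epsilon>) < 5 / 6" using e3 assms(1) by (simp add: field_simps)
  then have "(2 - 4 * \<epsilon>) / (3 - 4 * \<epsilon>) < a" using assms(3) by (simp add: a_def)
  then have a: "2 - 4 * \<epsilon> < a * (3 - 4 * \<epsilon>)" using e3 by (simp add: field_simps)
  have p: "p > 1" by (auto simp: p_def a_def)
  have "(\<lambda>n. real n powr (2 - \<alpha>)) \<in> O(\<lambda>n. real n powr p)"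
  proof (rule bigoI[of _ 1], rule eventually_mono[OF eventually_gt_at_top[of 0]])
    fix n :: nat assume "n > 0"
    then have "real n powr (2 - \<alpha>) \<le> real n powr p"
      by (intro powr_mono) (auto simp: p_def a_def)
    then show "norm (real n powr (2 - \<alpha>)) \<le> 1 * norm (real n powr p)" by simp
  qed
  with assms(5) have exH: "(\<lambda>n. real (ex_number n H)) \<in> O(\<lambda>n. real n powr p)"
    by (rule landau_o.big_trans)
  have exB': "(\<lambda>n. real (ex_number n (delete_vertex H v))) \<in> O(\<lambda>n. real n powr (1 + (1 - \<epsilon>)))"
    using exB by (simp add: bigtheta_def)
  have "1 - \<epsilon> \<ge> 1 / 2" using assms(2) by simp
  then obtain c where c: "c > 0" and sp: "\<And>G :: nat ugraph. simple_graph G \<Longrightarrow> free_of H G \<Longrightarrow>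
      edges G \<noteq> {} \<Longrightarrow> surplus G \<ge> c * real (card (edges G)) powr (1 - (1 - 1 / p) * (1 - \<epsilon>))"
    by (rule surplus_ge_if_locally_free[OF assms(4) v p _ exH exB']) (rule that)
  \<comment> \<open>The excess of the exponent \<open>1 - (1 - 1 / p) * (1 - \<epsilon>)\<close>
    over 3/4.\<close>
  define \<delta> where "\<delta> = 1 / 4 - (1 - 1 / p) * (1 - \<epsilon>)"
  \<comment> \<open>This is \<open>\<delta> > 0\<close> multiplied by \<open>4 * p\<close>, with
    \<open>p - 1 = 1 - a\<close>; expanded, it is the inequality \<open>a\<close>.\<close>
  have "4 * (1 - a) * (1 - \<epsilon>) < p" using a by (simp add: p_def algebra_simps)
  moreover have "(1 - 1 / p) * (1 - \<epsilon>) = (1 - a) * (1 - \<epsilon>) / p"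
    using p by (simp add: p_def field_simps)
  ultimately have \<delta>: "\<delta> > 0" using p by (simp add: \<delta>_def field_simps)
  have "sp_min m H \<ge> c * real m powr (3 / 4 + \<delta>)" if m: "m \<ge> 1" for m
  proof -
    let ?A = "{surplus G | G :: nat ugraph. simple_graph G \<and> card (edges G) = m \<and> free_of H G}"
    obtain G :: "nat ugraph" where G: "simple_graph G" "card (edges G) = m"
        "free_of (delete_vertex H v) G"
      using exists_free_graph_with_edges[of "delete_vertex H v" "2 - \<epsilon>" m] exB assms(2)
      by (auto simp: bigtheta_def)
    then have ne: "?A \<noteq> {}" using free_of_if_free_of_delete_vertex[of H v G] by blast
    have "c * real m powr (3 / 4 + \<delta>) \<le> surplus G"
      if "simple_graph G" "card (edges G) = m" "free_of H G" for G :: "nat ugraph"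
    proof -
      have "edges G \<noteq> {}" using that(2) m by auto
      then show ?thesis using sp[OF that(1,3)] that(2) by (simp add: \<delta>_def)
    qed
    then show ?thesis
      unfolding sp_min_def using ne by (subst Min_ge_iff[OF finite_sp_min_values]) auto
  qed
  then show ?thesis using \<delta> c by blast
qed

end
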